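(* Let $p$ be a prime, $n\ge1$, and let $\xi_0,\dots,\xi_{n-1}$ be i.i.d. random variables taking values in $\mathbb{Z}_p$. Let $f(X)=\xi_0+\xi_1X+\dots+\xi_{n-1}X^{n-1}+X^n$ and $f_0(X)=f(pX)$. If $\xi_i=0$ almost surely conditioned on $p\mid\xi_i$, then $$\mathbb{E}\left[C_{\mathbb{Z}_p}(f_0)\right]=\mathbb{P}(\xi_0=0).$$
   Context: $\mathbb{Z}_p$ is the ring of $p$-adic integers. $C_{\mathbb{Z}_p}(g)=\#\{x\in\mathbb{Z}_p: g(x)=0\}$ is the number of roots of $g$ in $\mathbb{Z}_p$, counted without multiplicities. The hypothesis "$\xi_i=0$ almost surely conditioned on $p\mid\xi_i$" means $\mathbb{P}(p\mid\xi_i \text{ and } \xi_i\neq0)=0$. *)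

theory Defs
  imports "HOL-Probability.Probability" "HOL-Algebra.UnivPoly" "HOL-Algebra.Divisibility"
begin

(* The ring of p-adic integers as the inverse limit of the rings Z/p^k: a p-adic integer
   is the sequence of its residues, where x k in {0..<p^k} stands for x mod p^k. *)
definition padic_int :: "nat \<Rightarrow> (nat \<Rightarrow> int) ring" where
  "padic_int p =
    \<lparr> carrier = {x. \<forall>k. x k \<in> {0..<int p ^ k} \<and> x (Suc k) mod int p ^ k = x k},
      mult = (\<lambda>x y k. (x k * y k) mod int p ^ k),
      one = (\<lambda>k. 1 mod int p ^ k),
      zero = (\<lambda>k. 0),
      add = (\<lambda>x y k. (x k + y k) mod int p ^ k) \<rparr>"

lemma cring_padic_int:
  assumes "p > 0"
  shows "cring (padic_int p)"
proof (intro cringI abelian_groupI comm_monoidI)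
  have pos: "int p ^ k > 0" for k
    using assms by simp
  have dvd: "int p ^ k dvd int p ^ Suc k" for k
    by simp
  have proj: "a mod int p ^ Suc k mod int p ^ k = a mod int p ^ k" for a k
    using dvd by (rule mod_mod_cancel)
  let ?R = "padic_int p"
  have add_closed: "x \<oplus>\<^bsub>?R\<^esub> y \<in> carrier ?R" if "x \<in> carrier ?R" "y \<in> carrier ?R" for x y
    using that pos proj by (auto simp: padic_int_def simp del: power_Suc) (metis mod_add_eq)
  have mult_closed: "x \<otimes>\<^bsub>?R\<^esub> y \<in> carrier ?R" if "x \<in> carrier ?R" "y \<in> carrier ?R" for x y
    using that pos proj by (auto simp: padic_int_def simp del: power_Suc) (metis mod_mult_eq)
  have red: "x k mod int p ^ k = x k" if "x \<in> carrier ?R" for x k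
    using that by (auto simp: padic_int_def)
  show "\<And>x y. x \<in> carrier ?R \<Longrightarrow> y \<in> carrier ?R \<Longrightarrow> x \<oplus>\<^bsub>?R\<^esub> y \<in> carrier ?R"
    by (rule add_closed)
  show "\<And>x y. x \<in> carrier ?R \<Longrightarrow> y \<in> carrier ?R \<Longrightarrow> x \<otimes>\<^bsub>?R\<^esub> y \<in> carrier ?R"
    by (rule mult_closed)
  show "\<zero>\<^bsub>?R\<^esub> \<in> carrier ?R" "\<one>\<^bsub>?R\<^esub> \<in> carrier ?R"
    using pos proj by (auto simp: padic_int_def simp del: power_Suc)
  show "\<And>x y z. x \<oplus>\<^bsub>?R\<^esub> y \<oplus>\<^bsub>?R\<^esub> z = x \<oplus>\<^bsub>?R\<^esub> (y \<oplus>\<^bsub>?R\<^esub> z)"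
    by (auto simp: padic_int_def fun_eq_iff mod_simps algebra_simps)
  show "\<And>x y z. x \<otimes>\<^bsub>?R\<^esub> y \<otimes>\<^bsub>?R\<^esub> z = x \<otimes>\<^bsub>?R\<^esub> (y \<otimes>\<^bsub>?R\<^esub> z)"
    by (auto simp: padic_int_def fun_eq_iff mod_simps algebra_simps)
  show "\<And>x y z. (x \<oplus>\<^bsub>?R\<^esub> y) \<otimes>\<^bsub>?R\<^esub> z = x \<otimes>\<^bsub>?R\<^esub> z \<oplus>\<^bsub>?R\<^esub> y \<otimes>\<^bsub>?R\<^esub> z"
    by (auto simp: padic_int_def fun_eq_iff mod_simps algebra_simps)
  show "\<And>x y. x \<oplus>\<^bsub>?R\<^esub> y = y \<oplus>\<^bsub>?R\<^esub> x" "\<And>x y. x \<otimes>\<^bsub>?R\<^esub> y = y \<otimes>\<^bsub>?R\<^esub> x"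
    by (auto simp: padic_int_def fun_eq_iff algebra_simps)
  show "\<And>x. x \<in> carrier ?R \<Longrightarrow> \<zero>\<^bsub>?R\<^esub> \<oplus>\<^bsub>?R\<^esub> x = x"
    "\<And>x. x \<in> carrier ?R \<Longrightarrow> \<one>\<^bsub>?R\<^esub> \<otimes>\<^bsub>?R\<^esub> x = x"
    using red by (auto simp: padic_int_def fun_eq_iff mod_simps)
  show "\<exists>y\<in>carrier ?R. y \<oplus>\<^bsub>?R\<^esub> x = \<zero>\<^bsub>?R\<^esub>" if x: "x \<in> carrier ?R" for x
  proof (rule bexI)
    let ?y = "\<lambda>k. (- x k) mod int p ^ k"
    show "?y \<oplus>\<^bsub>?R\<^esub> x = \<zero>\<^bsub>?R\<^esub>"
      by (auto simp: padic_int_def fun_eq_iff mod_simps)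
    show "?y \<in> carrier ?R"
      using x pos proj by (auto simp: padic_int_def simp del: power_Suc) (metis mod_minus_eq)
  qed
qed

(* The Borel sigma-algebra of the p-adic topology. The latter is the inverse limit topology,
   i.e. the one induced by the product topology on nat => int with int discrete. *)
definition padic_borel :: "nat \<Rightarrow> (nat \<Rightarrow> int) measure" where
  "padic_borel p = restrict_space borel (carrier (padic_int p))"

definition rand_poly :: "nat \<Rightarrow> nat \<Rightarrow> (nat \<Rightarrow> nat \<Rightarrow> int) \<Rightarrow> nat \<Rightarrow> nat \<Rightarrow> int" where
  "rand_poly p n a = (let R = padic_int p; P = UP R in
     (\<Oplus>\<^bsub>P\<^esub>i\<in>{..<n}. monom P (a i) i) \<oplus>\<^bsub>P\<^esub> monom P \<one>\<^bsub>R\<^esub> n)"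

definition subst_pX :: "nat \<Rightarrow> (nat \<Rightarrow> nat \<Rightarrow> int) \<Rightarrow> nat \<Rightarrow> nat \<Rightarrow> int" where
  "subst_pX p g = (let R = padic_int p; P = UP R in
     eval R P (\<lambda>c. monom P c 0) (monom P ([p] \<cdot>\<^bsub>R\<^esub> \<one>\<^bsub>R\<^esub>) 1) g)"

(* Only meaningful for g with finitely many roots, in particular for nonzero g,
   since card is 0 on infinite sets. *)
definition num_roots :: "nat \<Rightarrow> (nat \<Rightarrow> nat \<Rightarrow> int) \<Rightarrow> nat" where
  "num_roots p g = (let R = padic_int p in
     card {x \<in> carrier R. eval R R id x g = \<zero>\<^bsub>R\<^esub>})"

end

theory Submission
  imports Defs
begin

text \<open>
  Almost surely every coefficient \<open>\<xi>\<^sub>i\<close> is zero or a unit, and then the roots of \<open>f(pX)\<close> can be read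
  off. Let \<open>m\<close> be the least index of a nonzero coefficient of \<open>f\<close>, where the leading coefficient
  \<open>1\<close> guarantees \<open>m \<le> n\<close>. Then \<open>f(px) = (px)\<^sup>m u\<close>, where \<open>u\<close> is congruent modulo \<open>p\<close> to
  the unit \<open>\<xi>\<^sub>m\<close> (or to \<open>1\<close>) and so is a unit itself. For \<open>m = 0\<close> there is no root, and for
  \<open>m > 0\<close> the only root is \<open>0\<close>. Since \<open>m > 0\<close> means \<open>\<xi>\<^sub>0 = 0\<close>, the number of roots is almost
  surely the indicator of \<open>\<xi>\<^sub>0 = 0\<close> (\<open>padic_limit_approx_roots_units\<close>).

  The probability space may be incomplete, so equality almost everywhere with an indicator does
  not make the number of roots measurable: its behaviour on the exceptional null set matters, where
  the coefficients are arbitrary. For this part, a root is described as a compatible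
  sequence of approximate roots modulo the powers of \<open>p\<close>. By Koenig's lemma a residue class
  contains a root iff it contains approximate roots of every precision
  (\<open>koenig_inverse_limit\<close>), which is a countable condition on the residues of the coefficients.
  A set of p-adic integers has \<open>c > 0\<close> elements iff it meets exactly \<open>c\<close> residue classes modulo
  \<open>p ^ j\<close> for all large \<open>j\<close> (\<open>card_eq_iff_eventually_card_residues\<close>), so the number of roots is
  measurable (\<open>measurable_card_padic_limit\<close>).
\<close>

section \<open>Residues of p-adic integers\<close>

lemma padic_int_sel:
  "x \<oplus>\<^bsub>padic_int p\<^esub> y = (\<lambda>k. (x k + y k) mod int p ^ k)"
  "x \<otimes>\<^bsub>padic_int p\<^esub> y = (\<lambda>k. (x k * y k) mod int p ^ k)"
  "\<zero>\<^bsub>padic_int p\<^esub> = (\<lambda>k. 0)"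
  "\<one>\<^bsub>padic_int p\<^esub> = (\<lambda>k. 1 mod int p ^ k)"
  by (simp_all add: padic_int_def)

lemma padic_carrier_iff:
  "x \<in> carrier (padic_int p) \<longleftrightarrow>
     (\<forall>k. 0 \<le> x k \<and> x k < int p ^ k \<and> x (Suc k) mod int p ^ k = x k)"
  by (auto simp: padic_int_def)

lemma padic_nth_range:
  assumes "x \<in> carrier (padic_int p)"
  shows "x k \<in> {0..<int p ^ k}"
  using assms by (simp add: padic_carrier_iff)

lemma padic_nth_mod:
  assumes x: "x \<in> carrier (padic_int p)" and "j \<le> k"
  shows "x k mod int p ^ j = x j"
  using \<open>j \<le> k\<close>
proof (induction k rule: dec_induct)
  case base
  show ?case using padic_nth_range[OF x, of j] by simp
next
  case (step k)
  have "x (Suc k) mod int p ^ j = x (Suc k) mod int p ^ k mod int p ^ j"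
    using step.hyps by (simp add: mod_mod_cancel le_imp_power_dvd)
  also have "\<dots> = x j"
    using x step.IH by (simp add: padic_carrier_iff)
  finally show ?case .
qed

lemma sum_mod_cong:
  fixes f g :: "'a \<Rightarrow> int"
  assumes "\<And>i. i \<in> I \<Longrightarrow> f i mod m = g i mod m"
  shows "sum f I mod m = sum g I mod m"
proof -
  have "(\<Sum>i\<in>I. f i mod m) = (\<Sum>i\<in>I. g i mod m)"
    using assms by (rule sum.cong[OF refl])
  then show ?thesis
    by (metis mod_sum_eq)
qed

lemma padic_pow_nth: "(x [^]\<^bsub>padic_int p\<^esub> (i::nat)) k = x k ^ i mod int p ^ k"
  by (induction i) (simp_all add: nat_pow_def padic_int_sel mod_simps mult.commute)

lemma padic_of_nat_nth: "([m] \<cdot>\<^bsub>padic_int p\<^esub> \<one>\<^bsub>padic_int p\<^esub>) k = int m mod int p ^ k"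
  for m :: nat
proof (induction m)
  case (Suc m)
  have "[Suc m] \<cdot>\<^bsub>padic_int p\<^esub> \<one>\<^bsub>padic_int p\<^esub>
      = [m] \<cdot>\<^bsub>padic_int p\<^esub> \<one>\<^bsub>padic_int p\<^esub> \<oplus>\<^bsub>padic_int p\<^esub> \<one>\<^bsub>padic_int p\<^esub>"
    by (simp add: add_pow_def nat_pow_def)
  then show ?case
    using Suc by (simp add: padic_int_sel mod_simps add.commute)
qed (simp add: add_pow_def nat_pow_def padic_int_sel)

lemma padic_finsum_nth:
  assumes "p > 0" and "finite I" and "\<And>i. i \<in> I \<Longrightarrow> f i \<in> carrier (padic_int p)"
  shows "(\<Oplus>\<^bsub>padic_int p\<^esub>i\<in>I. f i) k = (\<Sum>i\<in>I. f i k) mod int p ^ k"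
proof -
  interpret cring "padic_int p"
    by (rule cring_padic_int) fact
  show ?thesis
    using assms(2,3)
    by (induction I rule: finite_induct) (simp_all add: padic_int_sel mod_simps Pi_def)
qed

text \<open>Dividing by \<open>p\<close> shifts the sequence of residues by one place, which is possible as soon
  as the residue modulo \<open>p\<close> vanishes.\<close>

lemma padic_p_divides_iff:
  assumes p: "p > 0" and x: "x \<in> carrier (padic_int p)"
  shows "([p] \<cdot>\<^bsub>padic_int p\<^esub> \<one>\<^bsub>padic_int p\<^esub>) divides\<^bsub>padic_int p\<^esub> x \<longleftrightarrow> x 1 = 0"
proof
  assume "([p] \<cdot>\<^bsub>padic_int p\<^esub> \<one>\<^bsub>padic_int p\<^esub>) divides\<^bsub>padic_int p\<^esub> x"
  then obtain y where "x = [p] \<cdot>\<^bsub>padic_int p\<^esub> \<one>\<^bsub>padic_int p\<^esub> \<otimes>\<^bsub>padic_int p\<^esub> y"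
    by (auto simp: factor_def)
  then have "x 1 = ([p] \<cdot>\<^bsub>padic_int p\<^esub> \<one>\<^bsub>padic_int p\<^esub>) 1 * y 1 mod int p ^ 1"
    by (simp add: padic_int_sel(2))
  then show "x 1 = 0"
    by (simp add: padic_of_nat_nth del: One_nat_def)
next
  assume x1: "x 1 = 0"
  define y where "y = (\<lambda>k. x (Suc k) div int p)"
  have dvd: "int p dvd x (Suc k)" for k
    using padic_nth_mod[OF x, of 1 "Suc k"] x1 by auto
  have "y \<in> carrier (padic_int p)"
    unfolding padic_carrier_iff
  proof (intro allI conjI)
    fix k
    have range: "0 \<le> x (Suc k)" "x (Suc k) < int p ^ k * int p"
      using padic_nth_range[OF x, of "Suc k"] by (simp_all add: mult.commute)
    then show "0 \<le> y k"
      using p by (simp add: y_def pos_imp_zdiv_nonneg_iff)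
    show "y k < int p ^ k"
      using range dvd[of k] p by (auto simp: y_def elim!: dvdE)
    have "int p * (y (Suc k) mod int p ^ k) = x (Suc (Suc k)) mod int p ^ Suc k"
      using dvd[of "Suc k"] by (simp add: y_def mult_mod_right)
    also have "\<dots> = int p * y k"
      using padic_nth_mod[OF x, of "Suc k" "Suc (Suc k)"] dvd[of k] by (simp add: y_def)
    finally show "y (Suc k) mod int p ^ k = y k"
      using p by simp
  qed
  moreover have "x = [p] \<cdot>\<^bsub>padic_int p\<^esub> \<one>\<^bsub>padic_int p\<^esub> \<otimes>\<^bsub>padic_int p\<^esub> y"
  proof
    fix k
    have "int p * y k mod int p ^ k = x (Suc k) mod int p ^ k"
      using dvd[of k] by (simp add: y_def)
    then show "x k = ([p] \<cdot>\<^bsub>padic_int p\<^esub> \<one>\<^bsub>padic_int p\<^esub> \<otimes>\<^bsub>padic_int p\<^esub> y) k"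
      using padic_nth_mod[OF x, of k "Suc k"]
      by (simp add: padic_int_sel(2) padic_of_nat_nth mod_simps)
  qed
  ultimately show "([p] \<cdot>\<^bsub>padic_int p\<^esub> \<one>\<^bsub>padic_int p\<^esub>) divides\<^bsub>padic_int p\<^esub> x"
    by (auto simp: factor_def)
qed

section \<open>Roots as compatible systems of approximate roots\<close>

text \<open>Evaluation after a substitution is a composition of two ring homomorphisms, so it can be
  computed monomial by monomial.\<close>

lemma (in cring) eval_subst_scaled_monic:
  assumes t: "t \<in> carrier R" and x: "x \<in> carrier R" and a: "\<And>i. i < n \<Longrightarrow> a i \<in> carrier R"
  defines "P \<equiv> UP R"
  shows "eval R R id x (eval R P (\<lambda>c. monom P c 0) (monom P t 1)
             ((\<Oplus>\<^bsub>P\<^esub>i\<in>{..<n}. monom P (a i) i) \<oplus>\<^bsub>P\<^esub> monom P \<one> n))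
       = (\<Oplus>i\<in>{..<n}. a i \<otimes> (t \<otimes> x) [^] i) \<oplus> (t \<otimes> x) [^] n"
proof -
  note sum_cong = finsum_cong'
  interpret UP_cring R P
    by unfold_locales (simp add: P_def)
  interpret subst: UP_pre_univ_prop R P "\<lambda>c. monom P c 0" P
    by unfold_locales (rule const_ring_hom)
  interpret ev: UP_pre_univ_prop R R id P
    by unfold_locales (simp add: id_ring_hom)
  define s where "s = monom P t 1"
  have s: "s \<in> carrier P"
    using t by (simp add: s_def)
  interpret h1: ring_hom_cring P P "eval R P (\<lambda>c. monom P c 0) s"
    by unfold_locales (rule subst.eval_ring_hom[OF s])
  interpret h2: ring_hom_cring P R "eval R R id x"
    by unfold_locales (rule ev.eval_ring_hom[OF x])
  have [simp]: "eval R R id x s = t \<otimes> x"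
    using ev.eval_monom[OF t x, of 1] x by (simp add: s_def)
  have mono: "eval R R id x (eval R P (\<lambda>c. monom P c 0) s (monom P c i)) = c \<otimes> (t \<otimes> x) [^] i"
    if c: "c \<in> carrier R" for c i
    using c s x by (simp add: subst.eval_monom ev.eval_const h2.ring.hom_nat_pow)
  have "(\<Oplus>i\<in>{..<n}. (eval R R id x \<circ> (eval R P (\<lambda>c. monom P c 0) s \<circ> (\<lambda>i. monom P (a i) i))) i)
      = (\<Oplus>i\<in>{..<n}. a i \<otimes> (t \<otimes> x) [^] i)"
    by (rule sum_cong) (use a t x in \<open>simp_all add: mono\<close>)
  then show ?thesis
    unfolding s_def[symmetric] using a t x by (simp add: mono Pi_def comp_def)
qed

text \<open>The value of \<open>f(pX)\<close> at the integer \<open>y\<close>, with every coefficient replaced by its residue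
  modulo \<open>p ^ k\<close>.\<close>

definition approx_value :: "nat \<Rightarrow> nat \<Rightarrow> (nat \<Rightarrow> nat \<Rightarrow> int) \<Rightarrow> nat \<Rightarrow> int \<Rightarrow> int" where
  "approx_value p n a k y = (\<Sum>i<n. a i k * (int p * y) ^ i) + (int p * y) ^ n"

definition approx_roots :: "nat \<Rightarrow> nat \<Rightarrow> (nat \<Rightarrow> nat \<Rightarrow> int) \<Rightarrow> nat \<Rightarrow> int set" where
  "approx_roots p n a k = {y \<in> {0..<int p ^ k}. int p ^ k dvd approx_value p n a k y}"

text \<open>The inverse limit of the sets \<open>A k\<close>, viewed inside the p-adic integers.\<close>

definition padic_limit :: "nat \<Rightarrow> (nat \<Rightarrow> int set) \<Rightarrow> (nat \<Rightarrow> int) set" where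
  "padic_limit p A = {x \<in> carrier (padic_int p). \<forall>k. x k \<in> A k}"

lemma num_roots_eq_card_limit:
  assumes p: "p > 0" and a: "\<And>i. i < n \<Longrightarrow> a i \<in> carrier (padic_int p)"
  shows "num_roots p (subst_pX p (rand_poly p n a)) = card (padic_limit p (approx_roots p n a))"
proof -
  let ?R = "padic_int p"
  interpret cring ?R
    by (rule cring_padic_int) fact
  let ?t = "[p] \<cdot>\<^bsub>?R\<^esub> \<one>\<^bsub>?R\<^esub>"
  have t: "?t \<in> carrier ?R"
    by simp
  have "eval ?R ?R id x (subst_pX p (rand_poly p n a)) = \<zero>\<^bsub>?R\<^esub> \<longleftrightarrow> (\<forall>k. x k \<in> approx_roots p n a k)"
    if x: "x \<in> carrier ?R" for x
  proof -
    have nth: "eval ?R ?R id x (subst_pX p (rand_poly p n a)) k = approx_value p n a k (x k) mod int p ^ k"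
      for k
    proof -
      have "eval ?R ?R id x (subst_pX p (rand_poly p n a))
          = (\<Oplus>\<^bsub>?R\<^esub>i\<in>{..<n}. a i \<otimes>\<^bsub>?R\<^esub> (?t \<otimes>\<^bsub>?R\<^esub> x) [^]\<^bsub>?R\<^esub> i) \<oplus>\<^bsub>?R\<^esub> (?t \<otimes>\<^bsub>?R\<^esub> x) [^]\<^bsub>?R\<^esub> n"
        unfolding subst_pX_def rand_poly_def Let_def
        using eval_subst_scaled_monic[OF t x a] by simp
      moreover have pow: "((?t \<otimes>\<^bsub>?R\<^esub> x) [^]\<^bsub>?R\<^esub> i) k = (int p * x k) ^ i mod int p ^ k" for i :: nat
        by (simp add: padic_pow_nth padic_int_sel(2) padic_of_nat_nth mod_simps)
      moreover have "(\<Oplus>\<^bsub>?R\<^esub>i\<in>{..<n}. a i \<otimes>\<^bsub>?R\<^esub> (?t \<otimes>\<^bsub>?R\<^esub> x) [^]\<^bsub>?R\<^esub> i) k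
          = (\<Sum>i<n. (a i \<otimes>\<^bsub>?R\<^esub> (?t \<otimes>\<^bsub>?R\<^esub> x) [^]\<^bsub>?R\<^esub> i) k) mod int p ^ k"
        using p a x t by (intro padic_finsum_nth) auto
      moreover have "\<dots> = (\<Sum>i<n. a i k * (int p * x k) ^ i) mod int p ^ k"
        by (intro sum_mod_cong) (simp add: padic_int_sel(2)[of p "a _"] pow mod_simps)
      ultimately show ?thesis
        by (simp add: padic_int_sel(1) approx_value_def mod_simps)
    qed
    show ?thesis
      using padic_nth_range[OF x]
      by (simp add: fun_eq_iff padic_int_sel(3) nth approx_roots_def dvd_eq_mod_eq_0)
  qed
  then show ?thesis
    by (auto simp: num_roots_def Let_def padic_limit_def intro!: arg_cong[where f = card])
qed

lemma approx_roots_range: "approx_roots p n a k \<subseteq> {0..<int p ^ k}"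
  by (auto simp: approx_roots_def)

lemma approx_roots_mod:
  assumes p: "p > 0" and a: "\<And>i. i < n \<Longrightarrow> a i \<in> carrier (padic_int p)"
    and y: "y \<in> approx_roots p n a (Suc k)"
  shows "y mod int p ^ k \<in> approx_roots p n a k"
proof -
  have "approx_value p n a k (y mod int p ^ k) mod int p ^ k
      = approx_value p n a (Suc k) y mod int p ^ k"
  proof -
    have "(\<Sum>i<n. a i k * (int p * (y mod int p ^ k)) ^ i) mod int p ^ k
        = (\<Sum>i<n. a i (Suc k) * (int p * y) ^ i) mod int p ^ k"
    proof (intro sum_mod_cong)
      fix i assume "i \<in> {..<n}"
      then have "a i k = a i (Suc k) mod int p ^ k"
        using padic_nth_mod[OF a, of i k "Suc k"] by simp
      moreover have "(int p * (y mod int p ^ k)) ^ i mod int p ^ k = (int p * y) ^ i mod int p ^ k"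
        by (metis power_mod mod_mult_right_eq)
      ultimately show "a i k * (int p * (y mod int p ^ k)) ^ i mod int p ^ k
          = a i (Suc k) * (int p * y) ^ i mod int p ^ k"
        by (metis mod_mult_eq mod_mod_trivial)
    qed
    moreover have "(int p * (y mod int p ^ k)) ^ n mod int p ^ k = (int p * y) ^ n mod int p ^ k"
      by (metis power_mod mod_mult_right_eq)
    ultimately show ?thesis
      unfolding approx_value_def by (rule mod_add_cong)
  qed
  moreover have "int p ^ k dvd approx_value p n a (Suc k) y"
    using y by (auto simp: approx_roots_def dest: dvd_mult_right)
  ultimately show ?thesis
    unfolding approx_roots_def dvd_eq_mod_eq_0 using p by simp
qed

section \<open>Counting the points of an inverse limit\<close>

text \<open>Koenig's lemma for the tree of residues: call a residue good if it lifts to elements of \<open>A K\<close>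
  for all \<open>K\<close>. A good residue has finitely many lifts by one level, so one of them is good again.
  Iterating this from \<open>c\<close> yields a point of the limit.\<close>

lemma koenig_inverse_limit:
  assumes p: "p > 0" and range: "\<And>k. A k \<subseteq> {0..<int p ^ k}"
    and compat: "\<And>k y. y \<in> A (Suc k) \<Longrightarrow> y mod int p ^ k \<in> A k"
  shows "(\<lambda>x. x j) ` padic_limit p A
       = {c \<in> {0..<int p ^ j}. \<forall>K\<ge>j. \<exists>z\<in>A K. z mod int p ^ j = c}"
proof (intro equalityI subsetI)
  fix c assume "c \<in> (\<lambda>x. x j) ` padic_limit p A"
  then show "c \<in> {c \<in> {0..<int p ^ j}. \<forall>K\<ge>j. \<exists>z\<in>A K. z mod int p ^ j = c}"
    using padic_nth_range padic_nth_mod by (fastforce simp: padic_limit_def)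
next
  define good where "good k c \<longleftrightarrow> (\<forall>K\<ge>k. \<exists>z\<in>A K. z mod int p ^ k = c)" for k c
  have lower: "z mod int p ^ k \<in> A k" if "k \<le> K" "z \<in> A K" for k K z
    using that
  proof (induction arbitrary: z rule: dec_induct)
    case base
    then show ?case using range[of k] by auto
  next
    case (step K)
    then have "z mod int p ^ K mod int p ^ k \<in> A k"
      using compat by blast
    then show ?case
      using step.hyps by (simp add: mod_mod_cancel le_imp_power_dvd)
  qed
  have good_in: "c \<in> A k" if "good k c" for k c
    using that range[of k] by (force simp: good_def)
  have extend: "\<exists>d. good (Suc k) d \<and> d mod int p ^ k = c" if c: "good k c" for k c
  proof (rule ccontr)
    assume neg: "\<not> ?thesis"
    \<comment> \<open>If no lift of \<open>c\<close> is good, each of the finitely many lifts dies at some level, and the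
      maximum of these levels contradicts the goodness of \<open>c\<close>.\<close>
    define D where "D = {d \<in> {0..<int p ^ Suc k}. d mod int p ^ k = c}"
    have "\<forall>d\<in>D. \<exists>K\<ge>Suc k. \<forall>z\<in>A K. z mod int p ^ Suc k \<noteq> d"
      using neg by (auto simp: good_def D_def)
    then obtain L where L: "\<And>d. d \<in> D \<Longrightarrow> L d \<ge> Suc k \<and> (\<forall>z\<in>A (L d). z mod int p ^ Suc k \<noteq> d)"
      by metis
    have fin: "finite D"
      unfolding D_def by (rule finite_subset[of _ "{0..<int p ^ Suc k}"]) auto
    define K where "K = Max (insert (Suc k) (L ` D))"
    have KL: "K \<ge> L d" if "d \<in> D" for d
      using fin that by (auto simp: K_def)
    have "K \<ge> Suc k"
      using fin by (simp add: K_def)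
    then have "k \<le> K"
      by simp
    then obtain z where z: "z \<in> A K" "z mod int p ^ k = c"
      using c unfolding good_def by blast
    let ?d = "z mod int p ^ Suc k"
    have d: "?d \<in> D"
      using z(2) p by (simp add: D_def mod_mod_cancel del: power_Suc) (simp add: mod_mod_cancel)
    then have "z mod int p ^ L ?d \<in> A (L ?d)"
      using lower z(1) KL by blast
    moreover have "z mod int p ^ L ?d mod int p ^ Suc k = ?d"
      using L[OF d] by (intro mod_mod_cancel le_imp_power_dvd) auto
    ultimately show False
      using L[OF d] by blast
  qed
  fix c assume "c \<in> {c \<in> {0..<int p ^ j}. \<forall>K\<ge>j. \<exists>z\<in>A K. z mod int p ^ j = c}"
  then have c: "good j c"
    by (simp add: good_def)
  obtain g where g: "\<And>i. good (j + i) (g i)" "g 0 = c" "\<And>i. g (Suc i) mod int p ^ (j + i) = g i"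
  proof -
    have "\<exists>g. \<forall>i. (good (j + i) (g i) \<and> (i = 0 \<longrightarrow> g i = c)) \<and> g (Suc i) mod int p ^ (j + i) = g i"
      by (rule dependent_nat_choice[where Q = "\<lambda>i x y. y mod int p ^ (j + i) = x"])
         (use c extend in auto)
    then show ?thesis
      using that by blast
  qed
  \<comment> \<open>The chain starts at level \<open>j\<close>, so \<open>g k\<close> lives modulo \<open>p ^ (j + k)\<close> and must be reduced to
    level \<open>k\<close>. This also fills in the levels below \<open>j\<close>.\<close>
  define x where "x k = g k mod int p ^ k" for k
  have gA: "g i \<in> A (j + i)" for i
    using good_in g(1) .
  have "x k \<in> A k" for k
    unfolding x_def using lower[of k "j + k"] gA by simp
  moreover have "x \<in> carrier (padic_int p)"
    unfolding padic_carrier_iff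
  proof (intro allI conjI)
    fix k
    have "x (Suc k) mod int p ^ k = g (Suc k) mod int p ^ k"
      by (simp add: x_def mod_mod_cancel)
    also have "\<dots> = g (Suc k) mod int p ^ (j + k) mod int p ^ k"
      by (simp add: mod_mod_cancel le_imp_power_dvd)
    also have "\<dots> = x k"
      using g(3) by (simp add: x_def)
    finally show "x (Suc k) mod int p ^ k = x k" .
  qed (use p in \<open>simp_all add: x_def\<close>)
  moreover have "x j = c"
  proof -
    have "g i mod int p ^ j = c" for i
    proof (induction i)
      case 0
      then show ?case using gA[of 0] range[of j] g(2) by auto
    next
      case (Suc i)
      have "g (Suc i) mod int p ^ j = g (Suc i) mod int p ^ (j + i) mod int p ^ j"
        by (simp add: mod_mod_cancel le_imp_power_dvd)
      then show ?case using Suc g(3) by simp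
    qed
    then show ?thesis by (simp add: x_def)
  qed
  ultimately show "c \<in> (\<lambda>x. x j) ` padic_limit p A"
    by (auto simp: padic_limit_def)
qed

text \<open>Two distinct p-adic integers differ from some level on, and a finite set has only finitely many
  pairs.\<close>

lemma eventually_inj_on_residue:
  assumes "finite T" and T: "T \<subseteq> carrier (padic_int p)"
  shows "\<exists>J. \<forall>j\<ge>J. inj_on (\<lambda>x. x j) T"
proof -
  have "\<exists>k. x \<noteq> y \<longrightarrow> x k \<noteq> y k" for x y :: "nat \<Rightarrow> int"
    by auto
  then obtain d where d: "\<And>x y :: nat \<Rightarrow> int. x \<noteq> y \<Longrightarrow> x (d x y) \<noteq> y (d x y)"
    by metis
  define J where "J = Max (insert 0 ((\<lambda>(x, y). d x y) ` (T \<times> T)))"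
  have J: "d x y \<le> J" if "x \<in> T" "y \<in> T" for x y
    unfolding J_def using that assms(1) by (intro Max_ge) auto
  have "inj_on (\<lambda>x. x j) T" if "j \<ge> J" for j
  proof (rule inj_onI, rule ccontr)
    fix x y assume xy: "x \<in> T" "y \<in> T" "x j = y j" "x \<noteq> y"
    then have "d x y \<le> j"
      using J that order_trans by blast
    then have "x j mod int p ^ d x y = x (d x y)" "y j mod int p ^ d x y = y (d x y)"
      using padic_nth_mod xy(1,2) T by blast+
    then have "x (d x y) = y (d x y)"
      using xy(3) by simp
    then show False
      using d xy(4) by blast
  qed
  then show ?thesis by blast
qed

text \<open>The case \<open>m = 0\<close> has to be excluded because infinite sets have cardinality \<open>0\<close>, although they
  meet more and more residue classes.\<close>

lemma card_eq_iff_eventually_card_residues: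
  assumes S: "S \<subseteq> carrier (padic_int p)" and "m > 0"
  shows "card S = m \<longleftrightarrow> (\<exists>J. \<forall>j\<ge>J. card ((\<lambda>x. x j) ` S) = m)"
proof
  assume "card S = m"
  moreover from this have "finite S"
    using \<open>m > 0\<close> card_ge_0_finite by blast
  ultimately show "\<exists>J. \<forall>j\<ge>J. card ((\<lambda>x. x j) ` S) = m"
    using eventually_inj_on_residue[OF _ S] card_image by metis
next
  assume "\<exists>J. \<forall>j\<ge>J. card ((\<lambda>x. x j) ` S) = m"
  then obtain J where J: "\<And>j. j \<ge> J \<Longrightarrow> card ((\<lambda>x. x j) ` S) = m"
    by blast
  have bound: "card T \<le> m" if T: "T \<subseteq> S" "finite T" for T
  proof -
    obtain J' where J': "\<And>j. j \<ge> J' \<Longrightarrow> inj_on (\<lambda>x. x j) T"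
      using eventually_inj_on_residue[of T p] T S by blast
    let ?j = "max J J'"
    have "card T = card ((\<lambda>x. x ?j) ` T)"
      using J' by (simp add: card_image)
    also have "\<dots> \<le> card ((\<lambda>x. x ?j) ` S)"
    proof (rule card_mono)
      show "finite ((\<lambda>x. x ?j) ` S)"
        by (rule finite_subset[of _ "{0..<int p ^ ?j}"]) (use S padic_nth_range in blast, simp)
    qed (use T in blast)
    finally show ?thesis
      using J by simp
  qed
  have "finite S"
  proof (rule ccontr)
    assume "infinite S"
    then obtain T where "T \<subseteq> S" "finite T" "card T = Suc m"
      by (meson infinite_arbitrarily_large)
    then show False using bound[of T] by simp
  qed
  then obtain J' where "\<And>j. j \<ge> J' \<Longrightarrow> inj_on (\<lambda>x. x j) S"
    using eventually_inj_on_residue S by blast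
  then show "card S = m"
    using J[of "max J J'"] by (simp add: card_image)
qed

text \<open>Positive cardinalities are recognised by the numbers of residue classes that meet the limit,
  which are measurable by Koenig's lemma. Cardinality \<open>0\<close>, which stands for empty as well as for
  infinite limits, is the complement of the positive ones.\<close>

lemma measurable_card_padic_limit:
  assumes p: "p > 0" and range: "\<And>\<omega> k. A \<omega> k \<subseteq> {0..<int p ^ k}"
    and compat: "\<And>\<omega> k y. \<omega> \<in> space M \<Longrightarrow> y \<in> A \<omega> (Suc k) \<Longrightarrow> y mod int p ^ k \<in> A \<omega> k"
    and meas: "\<And>k y. Measurable.pred M (\<lambda>\<omega>. y \<in> A \<omega> k)"
  shows "(\<lambda>\<omega>. card (padic_limit p (A \<omega>))) \<in> measurable M (count_space UNIV)"
proof -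
  note meas [measurable]
  \<comment> \<open>The number of residue classes modulo \<open>p ^ j\<close> that meet the limit, in a form that involves
    only countable quantifiers and membership in the sets \<open>A \<omega> K\<close>.\<close>
  define N where "N \<omega> j = (\<Sum>c\<in>{0..<int p ^ j}.
      if \<forall>K. K \<ge> j \<longrightarrow> (\<exists>z\<in>{0..<int p ^ K}. z \<in> A \<omega> K \<and> z mod int p ^ j = c) then 1 else 0 :: nat)" for \<omega> j
  have N: "N \<omega> j = card ((\<lambda>x. x j) ` padic_limit p (A \<omega>))" if "\<omega> \<in> space M" for \<omega> j
  proof -
    have "(\<exists>z\<in>{0..<int p ^ K}. z \<in> A \<omega> K \<and> z mod int p ^ j = c) \<longleftrightarrow> (\<exists>z\<in>A \<omega> K. z mod int p ^ j = c)"
      for K c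
      using range[of \<omega> K] by blast
    then show ?thesis
      by (simp add: N_def koenig_inverse_limit[OF p range compat[OF that]] sum.If_cases Int_def
          del: Collect_conj_eq)
  qed
  have N_meas [measurable]: "(\<lambda>\<omega>. N \<omega> j) \<in> measurable M (count_space UNIV)" for j
    unfolding N_def by measurable
  have pos: "Measurable.pred M (\<lambda>\<omega>. card (padic_limit p (A \<omega>)) = m)" if "m > 0" for m
  proof -
    have "Measurable.pred M (\<lambda>\<omega>. \<exists>J. \<forall>j. j \<ge> J \<longrightarrow> N \<omega> j = m)"
      by measurable
    also have "?this \<longleftrightarrow> ?thesis"
    proof (rule measurable_cong)
      fix \<omega> assume "\<omega> \<in> space M"
      then show "(\<exists>J. \<forall>j\<ge>J. N \<omega> j = m) = (card (padic_limit p (A \<omega>)) = m)"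
        using card_eq_iff_eventually_card_residues[of "padic_limit p (A \<omega>)" p, OF _ that]
        by (simp add: N padic_limit_def)
    qed
    finally show ?thesis .
  qed
  have "Measurable.pred M (\<lambda>\<omega>. card (padic_limit p (A \<omega>)) = m)" for m
  proof (cases "m = 0")
    case True
    have "(c = 0) = (\<not> (\<exists>k. c = Suc k))" for c :: nat
      by (cases c) auto
    then show ?thesis
      unfolding True using pos by simp
  qed (use pos in auto)
  then show ?thesis
    by (subst measurable_count_space_eq_countable) (auto simp: pred_def vimage_def Int_def conj_commute)
qed

section \<open>The roots when every coefficient is zero or a unit\<close>

text \<open>Divisibility of \<open>f(px) = (px)\<^sup>m u\<close> by \<open>p ^ K\<close> passes to \<open>(px)\<^sup>m\<close> because \<open>u\<close> is prime to \<open>p\<close>.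
  If \<open>m > 0\<close> and this holds for all \<open>K\<close>, then \<open>x\<close> is divisible by every power of \<open>p\<close>.\<close>

lemma padic_limit_approx_roots_units:
  assumes p: "Factorial_Ring.prime p" and "n \<ge> 1"
    and a: "\<And>i. i < n \<Longrightarrow> a i \<in> carrier (padic_int p)"
    and zu: "\<And>i. i < n \<Longrightarrow> a i = \<zero>\<^bsub>padic_int p\<^esub> \<or> a i 1 \<noteq> 0"
  shows "padic_limit p (approx_roots p n a)
       = (if a 0 = \<zero>\<^bsub>padic_int p\<^esub> then {\<zero>\<^bsub>padic_int p\<^esub>} else {})"
proof -
  have p0: "p > 0"
    using p by (simp add: prime_gt_0_nat)
  have pi: "Factorial_Ring.prime (int p)"
    using p by simp
  interpret cring "padic_int p"
    by (rule cring_padic_int) fact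
  \<comment> \<open>With the leading coefficient included, \<open>f(pX)\<close> becomes a single sum, from which the power of \<open>pX\<close> can be
    taken out.\<close>
  define b where "b i k = (if i < n then a i k else 1)" for i k
  define m where "m = (LEAST i. i = n \<or> a i \<noteq> \<zero>\<^bsub>padic_int p\<^esub>)"
  have m: "m = n \<or> a m \<noteq> \<zero>\<^bsub>padic_int p\<^esub>"
    unfolding m_def by (rule LeastI[where k = n]) simp
  have "m \<le> n"
    unfolding m_def by (rule Least_le) simp
  have below: "a i = \<zero>\<^bsub>padic_int p\<^esub>" if "i < m" for i
    using not_less_Least[OF that[unfolded m_def]] by simp
  have unit: "\<not> int p dvd b m k" if "k \<ge> 1" for k
  proof (cases "m < n")
    case True
    then have "a m k mod int p = a m 1" "a m 1 \<noteq> 0"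
      using padic_nth_mod[OF a[OF True] that] zu[OF True] m by auto
    then show ?thesis
      using True by (simp add: b_def dvd_eq_mod_eq_0)
  next
    case False
    then show ?thesis
      using p by (simp add: b_def prime_nat_iff)
  qed
  define u where "u k y = (\<Sum>i=m..n. b i k * (int p * y) ^ (i - m))" for k y
  have factor: "approx_value p n a k y = (int p * y) ^ m * u k y" for k y
  proof -
    have "approx_value p n a k y = (\<Sum>i\<le>n. b i k * (int p * y) ^ i)"
      by (simp add: approx_value_def b_def lessThan_Suc_atMost[symmetric])
    also have "\<dots> = (\<Sum>i=m..n. b i k * (int p * y) ^ i)"
      using below \<open>m \<le> n\<close> by (intro sum.mono_neutral_right) (auto simp: b_def padic_int_sel not_le)
    also have "\<dots> = (int p * y) ^ m * u k y"
      unfolding u_def sum_distrib_left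
      by (intro sum.cong) (auto simp: mult.left_commute simp flip: power_add)
    finally show ?thesis .
  qed
  have coprime_u: "coprime (int p ^ K) (u k y)" if "k \<ge> 1" for K k y
  proof -
    have "u k y = b m k + (\<Sum>i=Suc m..n. b i k * (int p * y) ^ (i - m))"
      unfolding u_def using \<open>m \<le> n\<close> by (subst sum.atLeast_Suc_atMost) simp_all
    moreover have "int p dvd (\<Sum>i=Suc m..n. b i k * (int p * y) ^ (i - m))"
      by (intro dvd_sum dvd_mult) (auto intro!: dvd_power_le[of "int p" "int p * y" 1, simplified])
    ultimately have "\<not> int p dvd u k y"
      using unit[OF that] by (simp add: dvd_add_left_iff)
    then show ?thesis
      using pi by (simp add: prime_imp_coprime)
  qed
  have dvd_pow: "int p ^ K dvd (int p * y) ^ m" if "K \<ge> 1" "y \<in> approx_roots p n a K" for K y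
    using that coprime_u[OF that(1), of K y]
    by (simp add: approx_roots_def factor coprime_dvd_mult_left_iff)
  have m0: "m = 0 \<longleftrightarrow> a 0 \<noteq> \<zero>\<^bsub>padic_int p\<^esub>"
    using m below[of 0] \<open>n \<ge> 1\<close> by (cases "m = 0") auto
  show ?thesis
  proof (cases "m = 0")
    case True
    have "approx_roots p n a 1 = {}"
      using dvd_pow[of 1] True p by (auto simp: prime_nat_iff)
    then show ?thesis
      using True m0 by (auto simp: padic_limit_def)
  next
    case False
    have "x = \<zero>\<^bsub>padic_int p\<^esub>" if x: "x \<in> padic_limit p (approx_roots p n a)" for x
    proof -
      have "x k = 0" for k
      proof -
        \<comment> \<open>At this level \<open>p ^ K\<close> is an \<open>m\<close>-th power, so that the exponent \<open>m\<close> cancels. The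
          extra factor \<open>p\<close> in \<open>Suc k\<close> is the one in \<open>px\<close>.\<close>
        define K where "K = m * Suc k"
        have K: "K \<ge> 1" "k \<le> K"
          using False by (simp_all add: K_def) (metis Suc_le_eq le_SucI mult_le_mono1 mult_1 not_gr0 trans_le_add2 One_nat_def)
        have "(int p ^ Suc k) ^ m dvd (int p * x K) ^ m"
          using dvd_pow[OF K(1), of "x K"] x
          by (simp add: padic_limit_def K_def power_mult[symmetric] mult.commute del: power_Suc)
        then have "int p ^ Suc k dvd int p * x K"
          using False by (simp add: pow_divides_pow_iff del: power_Suc)
        then have "int p ^ k dvd x K"
          using p0 by simp
        then show ?thesis
          using padic_nth_mod[of x p k K] x K by (auto simp: padic_limit_def)
      qed
      then show ?thesis
        by (auto simp: padic_int_sel)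
    qed
    moreover have "\<zero>\<^bsub>padic_int p\<^esub> \<in> padic_limit p (approx_roots p n a)"
    proof -
      have "approx_value p n a k 0 = 0" for k
        using False by (simp add: factor)
      then show ?thesis
        using p0 by (simp add: padic_limit_def approx_roots_def padic_int_sel(3) padic_carrier_iff)
    qed
    ultimately have "padic_limit p (approx_roots p n a) = {\<zero>\<^bsub>padic_int p\<^esub>}"
      by blast
    then show ?thesis
      using False m0 by (subst if_P) blast+
  qed
qed

section \<open>The expected number of roots\<close>

text \<open>The residue maps are the coordinate projections, which are continuous for the product
  topology.\<close>

lemma measurable_padic_residue:
  assumes "X \<in> measurable M (padic_borel p)"
  shows "(\<lambda>\<omega>. X \<omega> k) \<in> measurable M (count_space UNIV)"
proof -
  have "(\<lambda>x. x k) \<in> borel_measurable (borel :: (nat \<Rightarrow> int) measure)"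
    by (intro borel_measurable_continuous_onI continuous_on_product_coordinates)
  then have "(\<lambda>x. x k) \<in> measurable (padic_borel p) (borel :: int measure)"
    unfolding padic_borel_def by (rule measurable_restrict_space1)
  then have "(\<lambda>\<omega>. X \<omega> k) \<in> measurable M (borel :: int measure)"
    using assms by (rule measurable_compose[rotated])
  then show ?thesis
    by (simp add: measurable_cong_sets[OF refl sets_borel_eq_count_space])
qed

lemma measurable_sum_int:
  fixes f :: "nat \<Rightarrow> 'a \<Rightarrow> int"
  assumes "\<And>i. i < n \<Longrightarrow> f i \<in> measurable M (count_space UNIV)"
  shows "(\<lambda>\<omega>. \<Sum>i<n. f i \<omega>) \<in> measurable M (count_space UNIV)"
  using assms
proof (induction n)
  case (Suc n)
  have "(\<lambda>\<omega>. v + f n \<omega>) \<in> measurable M (count_space UNIV)" for v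
    by (rule measurable_compose[OF Suc.prems]) simp_all
  moreover have "(\<lambda>\<omega>. \<Sum>i<n. f i \<omega>) \<in> measurable M (count_space UNIV)"
    using Suc.prems by (intro Suc.IH) simp
  ultimately have "(\<lambda>\<omega>. (\<Sum>i<n. f i \<omega>) + f n \<omega>) \<in> measurable M (count_space UNIV)"
    by (rule measurable_compose_countable)
  then show ?case
    by simp
qed simp

theorem proposition3:
  fixes p n :: nat
    and M :: "'w measure"
    and \<xi> :: "nat \<Rightarrow> 'w \<Rightarrow> (nat \<Rightarrow> int)"
  assumes "Factorial_Ring.prime p"
    and "n \<ge> 1"
    and "prob_space M"
    and "prob_space.indep_vars M (\<lambda>_. padic_borel p) \<xi> {..<n}"
    and "\<forall>i<n. \<forall>j<n. distr M (padic_borel p) (\<xi> i) = distr M (padic_borel p) (\<xi> j)"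
    and "\<forall>i<n. measure M {\<omega> \<in> space M.
           ([p] \<cdot>\<^bsub>padic_int p\<^esub> \<one>\<^bsub>padic_int p\<^esub>) divides\<^bsub>padic_int p\<^esub> (\<xi> i \<omega>)
           \<and> \<xi> i \<omega> \<noteq> \<zero>\<^bsub>padic_int p\<^esub>} = 0"
  shows "integrable M (\<lambda>\<omega>. real (num_roots p (subst_pX p (rand_poly p n (\<lambda>i. \<xi> i \<omega>)))))
    \<and> (\<integral>\<omega>. real (num_roots p (subst_pX p (rand_poly p n (\<lambda>i. \<xi> i \<omega>)))) \<partial>M)
        = measure M {\<omega> \<in> space M. \<xi> 0 \<omega> = \<zero>\<^bsub>padic_int p\<^esub>}"
proof -
  interpret prob_space M
    by fact
  have p: "p > 0"
    using assms(1) by (simp add: prime_gt_0_nat)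
  have rv: "\<xi> i \<in> measurable M (padic_borel p)" if "i < n" for i
    using assms(4) that by (simp add: indep_vars_def)
  have carrier: "\<xi> i \<omega> \<in> carrier (padic_int p)" if "i < n" "\<omega> \<in> space M" for i \<omega>
    using measurable_space[OF rv[OF that(1)] that(2)] by (simp add: padic_borel_def space_restrict_space)
  have coord [measurable]: "(\<lambda>\<omega>. \<xi> i \<omega> k) \<in> measurable M (count_space UNIV)" if "i < n" for i k
    using measurable_padic_residue[OF rv[OF that]] .
  have zero_pred [measurable]: "Measurable.pred M (\<lambda>\<omega>. \<xi> i \<omega> = \<zero>\<^bsub>padic_int p\<^esub>)" if [measurable]: "i < n" for i
    unfolding padic_int_sel fun_eq_iff using that by measurable
  let ?N = "\<lambda>\<omega>. num_roots p (subst_pX p (rand_poly p n (\<lambda>i. \<xi> i \<omega>)))"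
  let ?Z = "{\<omega> \<in> space M. \<xi> 0 \<omega> = \<zero>\<^bsub>padic_int p\<^esub>}"
  have N: "?N \<omega> = card (padic_limit p (approx_roots p n (\<lambda>i. \<xi> i \<omega>)))" if "\<omega> \<in> space M" for \<omega>
    by (intro num_roots_eq_card_limit p carrier that)
  have "(\<lambda>\<omega>. card (padic_limit p (approx_roots p n (\<lambda>i. \<xi> i \<omega>)))) \<in> measurable M (count_space UNIV)"
  proof (rule measurable_card_padic_limit[OF p approx_roots_range])
    show "y mod int p ^ k \<in> approx_roots p n (\<lambda>i. \<xi> i \<omega>) k"
      if "\<omega> \<in> space M" "y \<in> approx_roots p n (\<lambda>i. \<xi> i \<omega>) (Suc k)" for \<omega> k y
      using approx_roots_mod[OF p _ that(2)] carrier that(1) by blast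
    have "(\<lambda>\<omega>. approx_value p n (\<lambda>i. \<xi> i \<omega>) k y) \<in> measurable M (count_space UNIV)" for k y
    proof -
      have "(\<lambda>\<omega>. \<Sum>i<n. \<xi> i \<omega> k * (int p * y) ^ i) \<in> measurable M (count_space UNIV)"
        by (intro measurable_sum_int measurable_compose[OF coord, where g = "\<lambda>v. v * _"]) simp_all
      then show ?thesis
        unfolding approx_value_def by (rule measurable_compose) simp
    qed
    then show "Measurable.pred M (\<lambda>\<omega>. y \<in> approx_roots p n (\<lambda>i. \<xi> i \<omega>) k)" for k y
      unfolding approx_roots_def by simp
  qed
  then have N_meas: "?N \<in> measurable M (count_space UNIV)"
    by (simp add: N cong: measurable_cong)
  have zero_or_unit: "AE \<omega> in M. \<xi> i \<omega> = \<zero>\<^bsub>padic_int p\<^esub> \<or> \<xi> i \<omega> 1 \<noteq> 0" if i: "i < n" for i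
  proof -
    have "{\<omega> \<in> space M. ([p] \<cdot>\<^bsub>padic_int p\<^esub> \<one>\<^bsub>padic_int p\<^esub>) divides\<^bsub>padic_int p\<^esub> (\<xi> i \<omega>)
           \<and> \<xi> i \<omega> \<noteq> \<zero>\<^bsub>padic_int p\<^esub>} = {\<omega> \<in> space M. \<xi> i \<omega> 1 = 0 \<and> \<xi> i \<omega> \<noteq> \<zero>\<^bsub>padic_int p\<^esub>}"
      using padic_p_divides_iff[OF p carrier[OF i]] by blast
    then have "prob {\<omega> \<in> space M. \<xi> i \<omega> 1 = 0 \<and> \<xi> i \<omega> \<noteq> \<zero>\<^bsub>padic_int p\<^esub>} = 0"
      using assms(6)[rule_format, OF i] by (simp only:)
    moreover have "{\<omega> \<in> space M. \<xi> i \<omega> 1 = 0 \<and> \<xi> i \<omega> \<noteq> \<zero>\<^bsub>padic_int p\<^esub>} \<in> events"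
      using coord[OF i, of 1] zero_pred[OF i] by measurable
    ultimately have "AE \<omega> in M. \<not> (\<xi> i \<omega> 1 = 0 \<and> \<xi> i \<omega> \<noteq> \<zero>\<^bsub>padic_int p\<^esub>)"
      by (simp only: prob_Collect_eq_0)
    then show ?thesis
      by eventually_elim auto
  qed
  have "AE \<omega> in M. \<forall>i\<in>{..<n}. \<xi> i \<omega> = \<zero>\<^bsub>padic_int p\<^esub> \<or> \<xi> i \<omega> 1 \<noteq> 0"
    using zero_or_unit by (intro AE_finite_allI) auto
  then have AE: "AE \<omega> in M. real (?N \<omega>) = indicator ?Z \<omega>"
    using AE_space
  proof eventually_elim
    case (elim \<omega>)
    then show ?case
      using padic_limit_approx_roots_units[OF assms(1,2), of "\<lambda>i. \<xi> i \<omega>"] carrier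
      by (simp add: N)
  qed
  have Z: "?Z \<in> events"
    using zero_pred[of 0] assms(2) by (simp add: pred_def)
  have meas: "(\<lambda>\<omega>. real (?N \<omega>)) \<in> borel_measurable M" "(indicator ?Z :: _ \<Rightarrow> real) \<in> borel_measurable M"
    using measurable_compose[OF N_meas, of real borel] Z by simp_all
  have "integrable M (indicator ?Z :: _ \<Rightarrow> real)"
    using Z by (simp add: emeasure_eq_measure)
  moreover have "(\<integral>\<omega>. indicator ?Z \<omega> \<partial>M) = measure M ?Z"
    using Z by simp
  ultimately show ?thesis
    using integrable_cong_AE[OF meas AE] integral_cong_AE[OF meas AE] by simp
qed

end
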